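(* Let $a>0$, $\omega>0$, let $\kappa$ be either $\sin$ or $\cos$, and let $N=\lfloor \omega a/\pi\rfloor+1$. For $m\ge1$, $1\le h\le N$, $0\le i\le m$ and $y\in[-a,a]$, let $$\varepsilon_m^{i,h}(y)=\int_{-1}^1\bar p_{m,i}\big(\gamma_h^{-1}(z)\big)\,\kappa\big(\omega(y-\gamma_h^{-1}(z))\big)\,dz-\sum_{k=1}^m\lambda_k\,\bar p_{m,i}\big(\gamma_h^{-1}(z_k)\big)\,\kappa\big(\omega(y-\gamma_h^{-1}(z_k))\big)$$ be the error of the $m$-point Gauss–Legendre rule. Then for each fixed $y\in[-a,a]$ there is a constant $\mathcal{C}>0$, not depending on $m$, such that for every $m\ge 1$, every $1\le h\le N$ and every $1\le i\le m$, $$|\varepsilon_m^{i,h}(y)|\le\frac{\mathcal{C}}{\sqrt{2\pi i}}\left(\frac{a}{N}\right)^m\left(m^{\frac{1}{2m}}\cdot\frac{m+\omega}{2m-1}\right)^m .$$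
   Context: Here $i$ is an integer index (not the imaginary unit). $\bar p_{m,i}(x)=\binom{m}{i}\left(\frac{a+x}{2a}\right)^i\left(\frac{a-x}{2a}\right)^{m-i}$ are the Bernstein basis polynomials on $[-a,a]$. The interval $[-a,a]$ is split into $N$ subintervals $[x_{h-1},x_h]$, $h=1,\dots,N$, with $x_h=-a+h\eta$ for $0\le h\le N$ and $\eta=2a/N$. The map $\gamma_h(x)=2\frac{x-x_{h-1}}{\eta}-1$ is the affine bijection $[x_{h-1},x_h]\to[-1,1]$, with inverse $\gamma_h^{-1}(z)=x_{h-1}+\frac{\eta}{2}(z+1)$. $z_1,\dots,z_m$ are the zeros of the $m$-th Legendre polynomial and $\lambda_1,\dots,\lambda_m$ the corresponding Christoffel numbers (Gauss–Legendre weights on $[-1,1]$). The constant $\mathcal{C}$ may depend on quantities other than $m$, such as $a$ and $\omega$. *)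

theory Defs
  imports "HOL-Analysis.Analysis" "HOL-Computational_Algebra.Polynomial"
begin

(* Rodrigues' formula: P_m = 1 / (2^m m!) (d/dx)^m (x^2 - 1)^m. *)
definition legendre_poly :: "nat \<Rightarrow> real poly" where
  "legendre_poly m = smult (1 / (2 ^ m * fact m)) ((pderiv ^^ m) ([:-1, 0, 1:] ^ m))"

(* The k-th zero in increasing order, k = 1, ..., m; the value is irrelevant for other k. *)
definition legendre_zero :: "nat \<Rightarrow> nat \<Rightarrow> real" where
  "legendre_zero m k = sorted_list_of_set {x. poly (legendre_poly m) x = 0} ! (k - 1)"

(* The Gauss-Legendre weight at the k-th zero: the integral over [-1,1] of the
   k-th fundamental Lagrange polynomial for the m zeros. *)
definition christoffel_number :: "nat \<Rightarrow> nat \<Rightarrow> real" where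
  "christoffel_number m k =
     integral {-1..1} (\<lambda>x. \<Prod>j\<in>{1..m} - {k}.
       (x - legendre_zero m j) / (legendre_zero m k - legendre_zero m j))"

definition gauss_legendre :: "nat \<Rightarrow> (real \<Rightarrow> real) \<Rightarrow> real" where
  "gauss_legendre m f = (\<Sum>k=1..m. christoffel_number m k * f (legendre_zero m k))"

definition bernstein_sym :: "real \<Rightarrow> nat \<Rightarrow> nat \<Rightarrow> real \<Rightarrow> real" where
  "bernstein_sym a m i x =
     real (m choose i) * ((a + x) / (2 * a)) ^ i * ((a - x) / (2 * a)) ^ (m - i)"

definition num_subintervals :: "real \<Rightarrow> real \<Rightarrow> nat" where
  "num_subintervals a \<omega> = nat \<lfloor>\<omega> * a / pi\<rfloor> + 1"

definition subinterval_width :: "real \<Rightarrow> nat \<Rightarrow> real" where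
  "subinterval_width a N = 2 * a / real N"

definition subinterval_node :: "real \<Rightarrow> nat \<Rightarrow> nat \<Rightarrow> real" where
  "subinterval_node a N h = - a + real h * subinterval_width a N"

definition subinterval_map :: "real \<Rightarrow> nat \<Rightarrow> nat \<Rightarrow> real \<Rightarrow> real" where
  "subinterval_map a N h x =
     2 * ((x - subinterval_node a N (h - 1)) / subinterval_width a N) - 1"

definition subinterval_map_inv :: "real \<Rightarrow> nat \<Rightarrow> nat \<Rightarrow> real \<Rightarrow> real" where
  "subinterval_map_inv a N h z =
     subinterval_node a N (h - 1) + subinterval_width a N / 2 * (z + 1)"

lemma subinterval_map_inverse:
  assumes "a > 0" "N > 0"
  shows "subinterval_map a N h (subinterval_map_inv a N h z) = z"
    and "subinterval_map_inv a N h (subinterval_map a N h x) = x"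
  using assms
  by (simp_all add: subinterval_map_def subinterval_map_inv_def subinterval_width_def field_simps)

definition quadrature_error ::
  "real \<Rightarrow> real \<Rightarrow> (real \<Rightarrow> real) \<Rightarrow> nat \<Rightarrow> nat \<Rightarrow> nat \<Rightarrow> real \<Rightarrow> real" where
  "quadrature_error a \<omega> \<kappa> m i h y =
     (let N = num_subintervals a \<omega>;
          g = (\<lambda>z. bernstein_sym a m i (subinterval_map_inv a N h z)
                     * \<kappa> (\<omega> * (y - subinterval_map_inv a N h z)))
      in integral {-1..1} g - gauss_legendre m g)"

end

theory Submission
  imports Defs
begin

text \<open>
  The $m$-point Gauss-Legendre rule is exact up to degree $2m-1$ and its weights are nonnegative with
  sum $2$, so its error on a function is at most $4$ times the distance of that function from the
  polynomials of degree at most $2m-1$. The Bernstein polynomial has degree $m$ and values in $[0,1]$;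
  replacing the trigonometric factor by its Taylor polynomial of degree $m-1$ costs at most
  $(\<omega>a/N)^m/m!$. The factorial absorbs every geometric factor: the error divided by
  $(a/(2N))^m$ is at most $4(2\<omega>)^m/m! \<le> 4 e^{2\<omega>}$.
\<close>

section \<open>Integrals of polynomials over [-1,1]\<close>

definition unit_integral :: "real poly \<Rightarrow> real" where
  "unit_integral p = integral {-1..1} (poly p)"

lemma poly_integrable [simp]: "poly p integrable_on {a..b::real}"
  by (intro integrable_continuous_real continuous_intros)

lemma unit_integral_add: "unit_integral (p + q) = unit_integral p + unit_integral q"
proof -
  have "poly (p + q) = (\<lambda>x. poly p x + poly q x)" by auto
  then show ?thesis by (simp add: unit_integral_def integral_add)
qed

lemma unit_integral_smult: "unit_integral (smult c p) = c * unit_integral p"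
proof -
  have "poly (smult c p) = (\<lambda>x. c * poly p x)" by auto
  then show ?thesis by (simp add: unit_integral_def)
qed

lemma unit_integral_0 [simp]: "unit_integral 0 = 0"
  using unit_integral_smult[of 0 0] by simp

lemma unit_integral_sum: "unit_integral (\<Sum>k\<in>A. f k) = (\<Sum>k\<in>A. unit_integral (f k))"
by (induction A rule: infinite_finite_induct) (simp_all add: unit_integral_add)

lemma unit_integral_pderiv: "unit_integral (pderiv p) = poly p 1 - poly p (-1)"
unfolding unit_integral_def
proof (rule integral_unique, rule fundamental_theorem_of_calculus)
  fix x :: real
  show "(poly p has_vector_derivative poly (pderiv p) x) (at x within {-1..1})"
    using poly_DERIV[of p x]
    by (metis DERIV_subset has_real_derivative_iff_has_vector_derivative subset_UNIV)
qed simp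

lemma unit_integral_by_parts:
  assumes "poly p 1 = 0" "poly p (-1) = 0"
  shows "unit_integral (pderiv p * q) = - unit_integral (p * pderiv q)"
proof -
  have "unit_integral (pderiv (p * q)) = 0"
    using assms by (simp add: unit_integral_pderiv)
  moreover have "pderiv (p * q) = pderiv p * q + p * pderiv q"
    by (simp add: pderiv_mult algebra_simps)
  ultimately show ?thesis by (simp add: unit_integral_add)
qed

section \<open>Derivatives of (x^2 - 1)^m: endpoints, orthogonality, roots\<close>

abbreviation rodrigues :: "nat \<Rightarrow> nat \<Rightarrow> real poly" where
  "rodrigues m k \<equiv> (pderiv ^^ k) ([:-1, 0, 1:] ^ m)"

lemma linear_power_dvd_pderiv:
  fixes p :: "'a :: idom poly"
  assumes "[:c, 1:] ^ Suc n dvd p"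
  shows "[:c, 1:] ^ n dvd pderiv p"
proof -
  obtain q where q: "p = [:c, 1:] ^ Suc n * q" using assms by auto
  have "pderiv p = [:c, 1:] ^ n * ([:c, 1:] * pderiv q + smult (of_nat (Suc n)) q)"
    unfolding q pderiv_mult pderiv_power_Suc by (simp add: algebra_simps pderiv_pCons)
  then show ?thesis by simp
qed

text \<open>(x^2 - 1)^m has a root of multiplicity m at each endpoint, and every derivative lowers
  the multiplicity by at most one.\<close>

lemma linear_power_dvd_rodrigues:
  assumes "k \<le> m" "c = 1 \<or> c = -1"
  shows "[:c, 1:] ^ (m - k) dvd rodrigues m k"
  using assms(1)
proof (induction k)
  case 0
  have "[:-1, 0, 1:] = [:c, 1:] * [:-c, 1 :: real:]" using assms(2) by auto
  then show ?case by (simp only: power_mult_distrib) simp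
next
  case (Suc k)
  then have "[:c, 1:] ^ Suc (m - Suc k) dvd rodrigues m k"
    by (metis Suc_diff_Suc Suc_leD Suc_le_lessD)
  then show ?case by (simp add: linear_power_dvd_pderiv del: power_Suc)
qed

lemma rodrigues_at_endpoints:
  assumes "k < m"
  shows "poly (rodrigues m k) 1 = 0" "poly (rodrigues m k) (-1) = 0"
proof -
  have "[:c, 1:] dvd rodrigues m k" if "c = 1 \<or> c = -1" for c
    by (rule dvd_trans[OF dvd_power linear_power_dvd_rodrigues]) (use assms that in auto)
  from this[of 1] this[of "-1"]
  show "poly (rodrigues m k) 1 = 0" "poly (rodrigues m k) (-1) = 0"
    by (auto simp: poly_eq_0_iff_dvd)
qed

text \<open>Each integration by parts moves one derivative onto \<open>q\<close>; the boundary terms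
  vanish because fewer than \<open>m\<close> derivatives are left. The disjunct \<open>q = 0\<close>
  keeps the induction going once \<open>q\<close> has been differentiated away, and it is all that
  remains at \<open>k = 0\<close>.\<close>

lemma rodrigues_orthogonal:
  assumes "k \<le> m" "q = 0 \<or> degree q < k"
  shows "unit_integral (rodrigues m k * q) = 0"
  using assms
proof (induction k arbitrary: q)
  case 0
  then show ?case by simp
next
  case (Suc k)
  have "pderiv q = 0 \<or> degree (pderiv q) < k"
    using Suc.prems(2) by (cases "degree q = 0") (auto simp: pderiv_eq_0_iff degree_pderiv)
  then have "unit_integral (rodrigues m k * pderiv q) = 0"
    using Suc.IH Suc.prems(1) by simp
  then show ?case
    using Suc.prems(1) by (simp add: unit_integral_by_parts rodrigues_at_endpoints)
qed

lemma degree_rodrigues: "degree (rodrigues m k) = 2 * m - k"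
proof (induction k)
  case 0
  then show ?case by (simp add: degree_power_eq)
qed (simp add: degree_pderiv)

text \<open>Rolle's theorem in each gap, with the points gathered into one choice function.\<close>

lemma poly_interlacing_roots:
  fixes p :: "real poly" and r :: "nat \<Rightarrow> real"
  assumes "\<And>j. j \<le> k \<Longrightarrow> r j < r (Suc j)" "\<And>j. j \<le> Suc k \<Longrightarrow> poly p (r j) = 0"
  shows "\<exists>s. \<forall>j\<le>k. r j < s j \<and> s j < r (Suc j) \<and> poly (pderiv p) (s j) = 0"
proof -
  have "\<exists>x. r j < x \<and> x < r (Suc j) \<and> poly (pderiv p) x = 0" if j: "j \<le> k" for j
    using poly_MVT[OF assms(1)[OF j], of p] assms(1)[OF j] assms(2)[of j] assms(2)[of "Suc j"] j
    by auto
  then show ?thesis by metis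
qed

text \<open>Induction on \<open>k\<close>: Rolle gives one root of the next derivative in each of
  the k+1 gaps, and both endpoints remain roots as long as fewer than \<open>m\<close> derivatives
  are taken. So each derivative gains one root.\<close>

lemma rodrigues_roots:
  assumes "k < m"
  shows "\<exists>r. (\<forall>j\<le>k. r j < r (Suc j)) \<and> r 0 = -1 \<and> r (Suc k) = 1 \<and>
             (\<forall>j\<le>Suc k. poly (rodrigues m k) (r j) = 0)"
  using assms
proof (induction k)
  case 0
  show ?case
    by (rule exI[of _ "\<lambda>j. if j = 0 then -1 else 1"]) (use 0 in auto)
next
  case (Suc k)
  then obtain r where r: "\<And>j. j \<le> k \<Longrightarrow> r j < r (Suc j)" "r 0 = -1" "r (Suc k) = 1"
    "\<And>j. j \<le> Suc k \<Longrightarrow> poly (rodrigues m k) (r j) = 0" by auto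
  obtain s where s: "\<And>j. j \<le> k \<Longrightarrow>
      r j < s j \<and> s j < r (Suc j) \<and> poly (pderiv (rodrigues m k)) (s j) = 0"
    using poly_interlacing_roots[of k r "rodrigues m k"] r(1,4) by metis
  \<comment> \<open>The Rolle points, shifted by one index, framed by the two endpoints.\<close>
  define t where "t = (\<lambda>j. if j = 0 then -1 else if j \<le> Suc k then s (j - 1) else 1)"
  have "t j < t (Suc j)" if j: "j \<le> Suc k" for j
  proof -
    consider "j = 0" | "0 < j" "j \<le> k" | "j = Suc k"
      using j by linarith
    then show ?thesis
    proof cases
      case 1
      then show ?thesis using s[of 0] r(2) by (simp add: t_def)
    next
      case 2
      then show ?thesis using s[of "j - 1"] s[of j] by (force simp: t_def)
    next
      case 3
      then show ?thesis using s[of k] r(3) by (simp add: t_def)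
    qed
  qed
  moreover have "poly (rodrigues m (Suc k)) (t j) = 0" if "j \<le> Suc (Suc k)" for j
    using rodrigues_at_endpoints[of "Suc k" m] Suc.prems s[of "j - 1"] that
    by (auto simp: t_def)
  moreover have "t 0 = -1" "t (Suc (Suc k)) = 1" by (auto simp: t_def)
  ultimately show ?case by blast
qed

section \<open>Legendre polynomials and their zeros\<close>

lemma legendre_poly_eq: "legendre_poly m = smult (1 / (2 ^ m * fact m)) (rodrigues m m)"
  by (simp add: legendre_poly_def)

lemma degree_legendre_poly [simp]: "degree (legendre_poly m) = m"
  by (simp add: legendre_poly_eq degree_rodrigues)

lemma legendre_poly_nonzero: "legendre_poly m \<noteq> 0"
proof (cases m)
  case (Suc n)
  then show ?thesis using degree_legendre_poly[of m] by (metis degree_0 nat.distinct(1))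
qed (simp add: legendre_poly_def)

lemma legendre_orthogonal:
  assumes "q = 0 \<or> degree q < m"
  shows "unit_integral (legendre_poly m * q) = 0"
  using rodrigues_orthogonal[of m m q] assms
  by (simp add: legendre_poly_eq unit_integral_smult)

text \<open>One last Rolle step: the m+1 roots of the derivative of order m-1 enclose m gaps, and
  each gap contains a root of the m-th derivative.\<close>

lemma card_legendre_roots_interior:
  "m \<le> card {x\<in>{-1<..<1}. poly (legendre_poly m) x = 0}"
proof (cases m)
  case (Suc k)
  obtain r where r: "\<And>j. j \<le> k \<Longrightarrow> r j < r (Suc j)" "r 0 = -1" "r (Suc k) = 1"
    "\<And>j. j \<le> Suc k \<Longrightarrow> poly (rodrigues m k) (r j) = 0"
    using rodrigues_roots[of k m] Suc by auto
  have mono: "r i \<le> r j" if "i \<le> j" "j \<le> Suc k" for i j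
    using that
  proof (induction j)
    case (Suc j)
    then show ?case using r(1)[of j] by (cases "i = Suc j") auto
  qed auto
  obtain s where s0: "\<And>j. j \<le> k \<Longrightarrow>
      r j < s j \<and> s j < r (Suc j) \<and> poly (pderiv (rodrigues m k)) (s j) = 0"
    using poly_interlacing_roots[of k r "rodrigues m k"] r(1,4) by metis
  have s: "r j < s j \<and> s j < r (Suc j) \<and> poly (legendre_poly m) (s j) = 0" if "j \<le> k" for j
    using s0[OF that] Suc by (simp add: legendre_poly_eq)
  \<comment> \<open>The gap holding \<open>s i\<close> ends no later than the gap holding
    \<open>s j\<close> begins, so the Rolle points are distinct.\<close>
  have "s i < s j" if "i < j" "j \<le> k" for i j
    using s[of i] s[of j] mono[of "Suc i" j] that by fastforce
  then have "inj_on s {..k}"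
    by (metis atMost_iff linorder_inj_onI' order_less_irrefl)
  then have "card (s ` {..k}) = m" using Suc by (simp add: card_image)
  moreover have "s ` {..k} \<subseteq> {x\<in>{-1<..<1}. poly (legendre_poly m) x = 0}"
  proof safe
    fix j assume j: "j \<le> k"
    show "s j \<in> {-1<..<1}"
      using s[OF j] mono[of 0 j] mono[of "Suc j" "Suc k"] j r(2,3) by auto
    show "poly (legendre_poly m) (s j) = 0" using s[OF j] by simp
  qed
  ultimately show ?thesis
    using card_mono[of "{x\<in>{-1<..<1}. poly (legendre_poly m) x = 0}" "s ` {..k}"]
      poly_roots_finite[OF legendre_poly_nonzero[of m]] by auto
qed simp

text \<open>The interior roots already exhaust the number that the degree allows, so there are no
  others.\<close>

lemma card_legendre_roots: "card {x. poly (legendre_poly m) x = 0} = m"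
  and legendre_roots_subset: "{x. poly (legendre_poly m) x = 0} \<subseteq> {-1<..<1}"
proof -
  let ?R = "{x. poly (legendre_poly m) x = 0}"
  let ?S = "{x\<in>{-1<..<1}. poly (legendre_poly m) x = 0}"
  have fin: "finite ?R" by (rule poly_roots_finite[OF legendre_poly_nonzero])
  have le: "card ?R \<le> m"
    using card_poly_roots_bound[OF legendre_poly_nonzero[of m]] by simp
  have "?S \<subseteq> ?R" by auto
  then have "card ?S \<le> card ?R" using fin by (rule card_mono[rotated])
  then show card: "card ?R = m" using le card_legendre_roots_interior[of m] by simp
  have "?S = ?R"
    using card_subset_eq[OF fin \<open>?S \<subseteq> ?R\<close>] card card_legendre_roots_interior[of m]
      \<open>card ?S \<le> card ?R\<close> by simp
  then show "?R \<subseteq> {-1<..<1}" by blast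
qed

text \<open>The sorted list of roots has length exactly \<open>m\<close>, so the shifted index
  \<open>k - 1\<close> stays in range for k = 1, ..., m.\<close>

lemma bij_betw_legendre_zero:
  "bij_betw (legendre_zero m) {1..m} {x. poly (legendre_poly m) x = 0}"
proof -
  let ?R = "{x. poly (legendre_poly m) x = 0}"
  let ?l = "sorted_list_of_set ?R"
  have fin: "finite ?R" by (rule poly_roots_finite[OF legendre_poly_nonzero])
  have "bij_betw ((!) ?l) {..<m} ?R"
    by (rule bij_betw_nth) (use fin in \<open>auto simp: card_legendre_roots\<close>)
  moreover have "bij_betw (\<lambda>k. k - 1) {1..m} {..<m}"
    by (rule bij_betwI[of _ _ _ Suc]) auto
  ultimately have "bij_betw ((!) ?l \<circ> (\<lambda>k. k - 1)) {1..m} ?R"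
    by (rule bij_betw_trans[rotated])
  then show ?thesis by (simp add: legendre_zero_def comp_def cong: bij_betw_cong)
qed

lemma legendre_zero_root:
  assumes "k \<in> {1..m}"
  shows "poly (legendre_poly m) (legendre_zero m k) = 0"
  using bij_betwE[OF bij_betw_legendre_zero] assms by auto

lemma legendre_zero_bounds:
  assumes "k \<in> {1..m}"
  shows "legendre_zero m k \<in> {-1..1}"
  using legendre_zero_root[OF assms] legendre_roots_subset[of m] by force

lemma inj_on_legendre_zero: "inj_on (legendre_zero m) {1..m}"
  using bij_betw_legendre_zero by (rule bij_betw_imp_inj_on)

section \<open>Lagrange interpolation and exactness of the Gauss-Legendre rule\<close>

definition legendre_lagrange :: "nat \<Rightarrow> nat \<Rightarrow> real poly" where
  "legendre_lagrange m k = (\<Prod>j\<in>{1..m} - {k}.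
     smult (1 / (legendre_zero m k - legendre_zero m j)) [:- legendre_zero m j, 1:])"

text \<open>Links the weights to polynomial objects, whose degrees and products the exactness
  argument needs.\<close>

lemma christoffel_number_eq:
  "christoffel_number m k = unit_integral (legendre_lagrange m k)"
  unfolding christoffel_number_def unit_integral_def
  by (rule integral_cong) (simp add: legendre_lagrange_def poly_prod diff_divide_distrib)

lemma degree_legendre_lagrange:
  assumes "k \<in> {1..m}"
  shows "degree (legendre_lagrange m k) < m"
proof -
  have "degree (legendre_lagrange m k) \<le> (\<Sum>j\<in>{1..m} - {k}. 1)"
    unfolding legendre_lagrange_def
    by (rule order.trans[OF degree_prod_sum_le])
      (auto simp only: comp_def finite_atLeastAtMost finite_Diff
        intro!: sum_mono order.trans[OF degree_smult_le] order.trans[OF degree_pCons_le], simp)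
  then show ?thesis using assms by simp linarith
qed

lemma legendre_lagrange_at_zero:
  assumes "k \<in> {1..m}" "l \<in> {1..m}"
  shows "poly (legendre_lagrange m k) (legendre_zero m l) = (if k = l then 1 else 0)"
proof (cases "k = l")
  case True
  have "legendre_zero m l - legendre_zero m j \<noteq> 0" if "j \<in> {1..m} - {l}" for j
    using inj_onD[OF inj_on_legendre_zero, of m l j] assms that by force
  then show ?thesis using True
    by (auto simp: legendre_lagrange_def poly_prod simp flip: diff_divide_distrib
        intro!: prod.neutral)
next
  case False
  then show ?thesis using assms by (auto simp: legendre_lagrange_def poly_prod intro!: bexI[of _ l])
qed

text \<open>Both sides have degree below \<open>m\<close> and agree at the \<open>m\<close> distinct
  zeros.\<close>

lemma lagrange_interpolation_at_legendre_zeros: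
  assumes "degree q < m"
  shows "q = (\<Sum>k=1..m. smult (poly q (legendre_zero m k)) (legendre_lagrange m k))"
proof (rule poly_eqI_degree)
  let ?A = "{x. poly (legendre_poly m) x = 0}"
  fix x assume "x \<in> ?A"
  then obtain l where l: "l \<in> {1..m}" "x = legendre_zero m l"
    using bij_betw_legendre_zero[of m] by (metis (no_types, lifting) bij_betw_def imageE)
  then have "poly (\<Sum>k=1..m. smult (poly q (legendre_zero m k)) (legendre_lagrange m k)) x
     = (\<Sum>k=1..m. if k = l then poly q x else 0)"
    unfolding poly_sum by (intro sum.cong) (simp_all add: legendre_lagrange_at_zero)
  then show "poly q x
      = poly (\<Sum>k=1..m. smult (poly q (legendre_zero m k)) (legendre_lagrange m k)) x"
    using l by simp
next
  show "degree q < card {x. poly (legendre_poly m) x = 0}"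
    using assms by (simp add: card_legendre_roots)
  show "degree (\<Sum>k=1..m. smult (poly q (legendre_zero m k)) (legendre_lagrange m k))
      < card {x. poly (legendre_poly m) x = 0}"
    unfolding card_legendre_roots
    by (rule degree_sum_less)
      (use assms in \<open>auto intro!: order.strict_trans1[OF degree_smult_le] degree_legendre_lagrange\<close>)
qed

text \<open>Division by the Legendre polynomial: the multiple of it has integral zero by
  orthogonality and vanishes at all nodes, while the remainder is integrated exactly through
  interpolation.\<close>

lemma gauss_legendre_exact:
  assumes "degree p < 2 * m"
  shows "unit_integral p = gauss_legendre m (poly p)"
proof -
  let ?P = "legendre_poly m"
  define d r where "d = p div ?P" and "r = p mod ?P"
  have p: "p = ?P * d + r" by (simp add: d_def r_def)
  have "m > 0" using assms by simp
  have r: "degree r < m"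
    using degree_mod_less[OF legendre_poly_nonzero, of p m] \<open>m > 0\<close> by (auto simp: r_def)
  have "degree d < m" if "d \<noteq> 0"
  proof -
    from that have "degree (?P * d) = m + degree d"
      by (simp add: degree_mult_eq legendre_poly_nonzero)
    \<comment> \<open>The remainder has degree below \<open>m\<close> and cannot cancel the leading
      term of the product.\<close>
    then have "degree p = m + degree d"
      unfolding p using r by (simp add: degree_add_eq_left)
    then show ?thesis using assms by simp
  qed
  then have "unit_integral p = unit_integral r"
    using legendre_orthogonal[of d m] by (auto simp: p unit_integral_add)
  also have "\<dots> = (\<Sum>k=1..m. poly r (legendre_zero m k) * christoffel_number m k)"
    by (subst lagrange_interpolation_at_legendre_zeros[OF r])
      (simp add: unit_integral_sum unit_integral_smult christoffel_number_eq)
  also have "\<dots> = gauss_legendre m (poly p)"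
    unfolding gauss_legendre_def p
    by (intro sum.cong) (simp_all add: legendre_zero_root)
  finally show ?thesis .
qed

text \<open>The squared fundamental polynomial has degree at most 2m-2, so the rule is exact on it;
  the rule returns the k-th weight, and the integral of a square is nonnegative.\<close>

lemma christoffel_number_nonneg:
  assumes "k \<in> {1..m}"
  shows "christoffel_number m k \<ge> 0"
proof -
  let ?L = "legendre_lagrange m k"
  have "degree (?L ^ 2) < 2 * m"
    using degree_power_le[of ?L 2] degree_legendre_lagrange[OF assms] by simp
  then have "unit_integral (?L ^ 2) = gauss_legendre m (poly (?L ^ 2))"
    by (rule gauss_legendre_exact)
  also have "\<dots> = (\<Sum>j=1..m. if j = k then christoffel_number m j else 0)"
    unfolding gauss_legendre_def
    by (intro sum.cong) (use assms in \<open>auto simp: legendre_lagrange_at_zero\<close>)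
  also have "\<dots> = christoffel_number m k" using assms by simp
  finally show ?thesis
    using integral_nonneg[of "poly (?L ^ 2)" "{-1..1}"]
    by (simp add: unit_integral_def)
qed

lemma sum_christoffel_number:
  assumes "m \<ge> 1"
  shows "(\<Sum>k=1..m. christoffel_number m k) = 2"
proof -
  have "poly (1 :: real poly) = (\<lambda>x. 1)" by (simp add: fun_eq_iff)
  then have "unit_integral 1 = 2" by (simp add: unit_integral_def)
  then show ?thesis using gauss_legendre_exact[of 1 m] assms by (simp add: gauss_legendre_def)
qed

text \<open>By exactness \<open>q\<close> drops out. The difference of \<open>g\<close> and
  \<open>q\<close> costs 2e in the integral, the interval having length 2, and 2e in the sum, the
  weights being nonnegative with sum 2.\<close>

lemma gauss_legendre_error_le:
  assumes "m \<ge> 1" and "continuous_on {-1..1} g" and "degree q < 2 * m"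
    and "\<And>x. x \<in> {-1..1} \<Longrightarrow> \<bar>g x - poly q x\<bar> \<le> e"
  shows "\<bar>integral {-1..1} g - gauss_legendre m g\<bar> \<le> 4 * e"
proof -
  have "g integrable_on {-1..1}"
    using assms(2) by (rule integrable_continuous_real)
  then have "integral {-1..1} g - unit_integral q = integral {-1..1} (\<lambda>x. g x - poly q x)"
    by (simp add: unit_integral_def integral_diff)
  moreover have "norm (integral {-1..1} (\<lambda>x. g x - poly q x)) \<le> e * (1 - (-1))"
    by (rule integral_bound) (use assms in \<open>auto intro!: continuous_intros\<close>)
  ultimately have int: "\<bar>integral {-1..1} g - unit_integral q\<bar> \<le> 2 * e" by simp
  have "gauss_legendre m (poly q) - gauss_legendre m g
      = (\<Sum>k=1..m. christoffel_number m k * (poly q (legendre_zero m k) - g (legendre_zero m k)))"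
    by (simp add: gauss_legendre_def sum_subtractf right_diff_distrib)
  also have "\<bar>\<dots>\<bar> \<le> (\<Sum>k=1..m. christoffel_number m k * e)"
  proof (rule order.trans[OF sum_abs], rule sum_mono)
    fix k assume k: "k \<in> {1..m}"
    then show "\<bar>christoffel_number m k * (poly q (legendre_zero m k) - g (legendre_zero m k))\<bar>
        \<le> christoffel_number m k * e"
      using assms(4)[OF legendre_zero_bounds[OF k]] christoffel_number_nonneg[OF k]
      by (simp add: abs_mult abs_minus_commute mult_left_mono)
  qed
  also have "\<dots> = 2 * e"
    using sum_christoffel_number[OF assms(1)] by (simp flip: sum_distrib_right)
  finally show ?thesis
    using int gauss_legendre_exact[OF assms(3)] by simp
qed

section \<open>Approximating and bounding the factors of the integrand\<close>

lemma sin_taylor_poly: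
  fixes A B :: real
  assumes "m \<ge> 1"
  obtains q where "degree q < m"
    and "\<And>z. \<bar>z\<bar> \<le> 1 \<Longrightarrow> \<bar>sin (A - B * z) - poly q z\<bar> \<le> \<bar>B\<bar> ^ m / fact m"
proof
  \<comment> \<open>The n-th derivative of sin(A - t) in t is a phase shift by n pi/2: one formula
    serves all orders and is bounded by 1.\<close>
  define diff where "diff = (\<lambda>(n::nat) t. sin (A - t - real n * (pi / 2)))"
  \<comment> \<open>The Maclaurin expansion is taken at t = B z, so the powers of \<open>B\<close>
    move into the coefficients.\<close>
  define q where "q = (\<Sum>n<m. monom (diff n 0 / fact n * B ^ n) n)"
  show "degree q < m" unfolding q_def
    by (rule degree_sum_less) (use assms in \<open>auto intro: order.strict_trans1[OF degree_monom_le]\<close>)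
  fix z :: real assume z: "\<bar>z\<bar> \<le> 1"
  have der: "\<forall>n x. DERIV (diff n) x :> diff (Suc n) x"
  proof (intro allI)
    fix n x
    have "diff (Suc n) x = - cos (A - x - real n * (pi / 2))"
      using sin_diff[of "A - x - real n * (pi / 2)" "pi / 2"]
      by (simp add: diff_def algebra_simps add_divide_distrib)
    then show "DERIV (diff n) x :> diff (Suc n) x"
      unfolding diff_def by (auto intro!: derivative_eq_intros)
  qed
  obtain t where "diff 0 (B * z) = (\<Sum>n<m. diff n 0 / fact n * (B * z) ^ n)
      + diff m t / fact m * (B * z) ^ m"
    using Maclaurin_all_le[OF refl der] by blast
  then have "sin (A - B * z) - poly q z = diff m t / fact m * (B * z) ^ m"
    by (simp add: q_def poly_sum poly_monom diff_def power_mult_distrib mult.assoc)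
  also have "\<bar>\<dots>\<bar> = \<bar>diff m t\<bar> * (\<bar>B\<bar> * \<bar>z\<bar>) ^ m / fact m"
    by (simp add: abs_mult power_abs)
  also have "\<dots> \<le> 1 * \<bar>B\<bar> ^ m / fact m"
    using z by (intro divide_right_mono mult_mono power_mono)
      (auto simp: diff_def mult_left_le)
  finally show "\<bar>sin (A - B * z) - poly q z\<bar> \<le> \<bar>B\<bar> ^ m / fact m" by simp
qed

text \<open>The value is one of the nonnegative terms in the binomial expansion of (t + (1 - t))^m =
  1.\<close>

lemma bernstein_sym_bounds:
  assumes "a > 0" "x \<in> {-a..a}" "i \<le> m"
  shows "bernstein_sym a m i x \<in> {0..1}"
proof -
  define t where "t = (a + x) / (2 * a)"
  have t: "(a - x) / (2 * a) = 1 - t" "0 \<le> t" "t \<le> 1"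
    using assms by (auto simp: t_def field_simps)
  have "real (m choose i) * t ^ i * (1 - t) ^ (m - i)
      \<le> (\<Sum>k\<le>m. real (m choose k) * t ^ k * (1 - t) ^ (m - k))"
    by (rule member_le_sum) (use assms t in auto)
  also have "\<dots> = (t + (1 - t)) ^ m" by (simp only: binomial_ring)
  finally show ?thesis using t by (simp add: bernstein_sym_def t(1) flip: t_def)
qed

lemma bernstein_sym_affine_poly:
  assumes "i \<le> m"
  obtains p where "degree p \<le> m" "\<And>z. bernstein_sym a m i (b + c * z) = poly p z"
proof
  let ?u = "[:(a + b) / (2 * a), c / (2 * a):]"
  let ?v = "[:(a - b) / (2 * a), - c / (2 * a):]"
  let ?p = "smult (real (m choose i)) (?u ^ i * ?v ^ (m - i))"
  have "degree (?u ^ i) \<le> i" "degree (?v ^ (m - i)) \<le> m - i"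
    using degree_power_le[of ?u i] degree_power_le[of ?v "m - i"]
    by (auto split: if_splits)
  then show "degree ?p \<le> m"
    using degree_mult_le[of "?u ^ i" "?v ^ (m - i)"] assms
      degree_smult_le[of "real (m choose i)" "?u ^ i * ?v ^ (m - i)"] by linarith
  show "bernstein_sym a m i (b + c * z) = poly ?p z" for z
  proof -
    have "(a + (b + c * z)) / (2 * a) = poly ?u z" "(a - (b + c * z)) / (2 * a) = poly ?v z"
      by (simp_all add: add_divide_distrib diff_divide_distrib)
    then show ?thesis by (simp only: bernstein_sym_def poly_smult poly_mult poly_power mult.assoc)
  qed
qed

lemma subinterval_map_inv_bounds:
  assumes "a > 0" "h \<in> {1..N}" "z \<in> {-1..1}"
  shows "subinterval_map_inv a N h z \<in> {-a..a}"
proof -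
  \<comment> \<open>Measured from -a in half-widths a/N, the point lies between 0 and 2N.\<close>
  have "subinterval_map_inv a N h z = -a + (a / real N) * (2 * (real h - 1) + (z + 1))"
    using assms
    by (simp add: subinterval_map_inv_def subinterval_node_def subinterval_width_def
        of_nat_diff field_simps)
  moreover have "0 \<le> (a / real N) * (2 * (real h - 1) + (z + 1))"
    using assms by (intro mult_nonneg_nonneg) auto
  moreover have "(a / real N) * (2 * (real h - 1) + (z + 1)) \<le> (a / real N) * (2 * real N)"
    using assms by (intro mult_left_mono) auto
  ultimately show ?thesis using assms by simp
qed

section \<open>The quadrature error and the final estimate\<close>

lemma quadrature_error_le:
  assumes "a > 0" "\<omega> > 0" "\<kappa> = sin \<or> \<kappa> = cos" "N = num_subintervals a \<omega>"
    and "m \<ge> 1" "h \<in> {1..N}" "i \<le> m"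
  shows "\<bar>quadrature_error a \<omega> \<kappa> m i h y\<bar> \<le> 4 * ((\<omega> * a / real N) ^ m / fact m)"
proof -
  \<comment> \<open>\<open>b\<close> is the midpoint and \<open>c\<close> the half-width of the h-th
    subinterval.\<close>
  define b where "b = subinterval_node a N (h - 1) + a / real N"
  define c where "c = a / real N"
  have inv: "subinterval_map_inv a N h z = b + c * z" for z
    by (simp add: subinterval_map_inv_def subinterval_width_def b_def c_def
        add_divide_distrib algebra_simps)
  obtain p where p: "degree p \<le> m" "\<And>z. bernstein_sym a m i (b + c * z) = poly p z"
    using bernstein_sym_affine_poly \<open>i \<le> m\<close> by metis
  \<comment> \<open>A phase \<open>d\<close> of 0 or pi/2 treats sine and cosine together.\<close>
  obtain d where d: "\<And>u. \<kappa> u = sin (u + d)"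
  proof (cases "\<kappa> = sin")
    case True
    then show ?thesis using that[of 0] by simp
  next
    case False
    then have "\<kappa> = cos" using assms(3) by simp
    then show ?thesis using that[of "pi / 2"] by (simp add: sin_add)
  qed
  define A where "A = \<omega> * (y - b) + d"
  have \<kappa>: "\<kappa> (\<omega> * (y - (b + c * z))) = sin (A - \<omega> * c * z)" for z
    by (simp add: d A_def algebra_simps)
  obtain q where q: "degree q < m"
    "\<And>z. \<bar>z\<bar> \<le> 1 \<Longrightarrow> \<bar>sin (A - \<omega> * c * z) - poly q z\<bar> \<le> \<bar>\<omega> * c\<bar> ^ m / fact m"
    using sin_taylor_poly[of m A "\<omega> * c"] \<open>m \<ge> 1\<close> by blast
  let ?g = "\<lambda>z. poly p z * sin (A - \<omega> * c * z)"
  have "\<bar>integral {-1..1} ?g - gauss_legendre m ?g\<bar> \<le> 4 * (\<bar>\<omega> * c\<bar> ^ m / fact m)"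
  proof (rule gauss_legendre_error_le[where q = "p * q"])
    \<comment> \<open>At most m + (m-1) = 2m-1, the limit of exactness; this fixes the order of the
      Taylor polynomial.\<close>
    show "degree (p * q) < 2 * m"
      using degree_mult_le[of p q] p(1) q(1) by linarith
    fix z :: real assume z: "z \<in> {-1..1}"
    have "poly p z \<in> {0..1}"
      using bernstein_sym_bounds[OF assms(1) subinterval_map_inv_bounds[OF assms(1,6) z] assms(7)]
      by (simp add: inv p)
    then have "\<bar>poly p z\<bar> * \<bar>sin (A - \<omega> * c * z) - poly q z\<bar> \<le> 1 * (\<bar>\<omega> * c\<bar> ^ m / fact m)"
      using q(2)[of z] z by (intro mult_mono) auto
    then show "\<bar>?g z - poly (p * q) z\<bar> \<le> \<bar>\<omega> * c\<bar> ^ m / fact m"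
      by (simp add: right_diff_distrib flip: abs_mult)
  qed (use \<open>m \<ge> 1\<close> in \<open>auto intro!: continuous_intros\<close>)
  moreover have "quadrature_error a \<omega> \<kappa> m i h y = integral {-1..1} ?g - gauss_legendre m ?g"
    unfolding quadrature_error_def Let_def assms(4)[symmetric] inv p(2) \<kappa> ..
  ultimately show ?thesis
    using assms(1,2) by (simp add: c_def)
qed

text \<open>A single term of the exponential series is at most its sum.\<close>

lemma power_le_fact_exp:
  fixes x :: real
  assumes "x \<ge> 0"
  shows "x ^ m \<le> fact m * exp x"
proof -
  have "(\<Sum>n\<in>{m}. x ^ n /\<^sub>R fact n) \<le> (\<Sum>n. x ^ n /\<^sub>R fact n)"
    by (rule sum_le_suminf) (use assms summable_exp_generic[of x] in auto)
  then show ?thesis by (simp add: exp_def field_simps)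
qed

theorem theorem3p2:
  fixes a \<omega> y :: real and \<kappa> :: "real \<Rightarrow> real" and N :: nat
  assumes "a > 0" and "\<omega> > 0"
    and "\<kappa> = sin \<or> \<kappa> = cos"
    and "N = num_subintervals a \<omega>"
    and "y \<in> {-a..a}"
  shows "\<exists>C>0. \<forall>m\<ge>1. \<forall>h\<in>{1..N}. \<forall>i\<in>{1..m}.
           \<bar>quadrature_error a \<omega> \<kappa> m i h y\<bar>
             \<le> C / sqrt (2 * pi * real i) * (a / real N) ^ m
                 * (real m powr (1 / (2 * real m)) * ((real m + \<omega>) / (2 * real m - 1))) ^ m"
proof (intro exI[of _ "4 * exp (2 * \<omega>) * sqrt (2 * pi)"] conjI allI impI ballI)
  fix m h i :: nat
  assume m: "m \<ge> 1" and h: "h \<in> {1..N}" and i: "i \<in> {1..m}"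
  \<comment> \<open>4 comes from the quadrature estimate, exp(2 omega) bounds (2 omega)^m/m!, and
    sqrt(2 pi) cancels its counterpart in the denominator.\<close>
  let ?C = "4 * exp (2 * \<omega>) * sqrt (2 * pi)"
  have "(real m powr (1 / (2 * real m))) ^ m = real m powr (1 / 2)"
    using m by (simp add: powr_powr flip: powr_realpow)
  then have root: "(real m powr (1 / (2 * real m))) ^ m = sqrt (real m)"
    by (simp add: powr_half_sqrt)
  \<comment> \<open>The last factor of the bound may be nearly as small as 2^(-m), so a factor
    2^(-m) has to be gained from the factorial.\<close>
  have "1 / 2 \<le> (real m + \<omega>) / (2 * real m - 1)"
    using m assms(2) by (simp add: field_simps)
  then have half: "(1 / 2) ^ m \<le> ((real m + \<omega>) / (2 * real m - 1)) ^ m"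
    by (rule power_mono) simp
  \<comment> \<open>The factor sqrt(m) extracted from the power outweighs 1/sqrt(i), since i <=
    m.\<close>
  have "?C / sqrt (2 * pi * real i) * sqrt (real m) = 4 * exp (2 * \<omega>) * sqrt (real m / real i)"
    using i by (simp add: real_sqrt_mult real_sqrt_divide)
  moreover have "1 \<le> sqrt (real m / real i)"
    using i by simp
  ultimately have C: "4 * exp (2 * \<omega>) \<le> ?C / sqrt (2 * pi * real i) * sqrt (real m)"
    by simp
  have "\<bar>quadrature_error a \<omega> \<kappa> m i h y\<bar> \<le> 4 * ((\<omega> * a / real N) ^ m / fact m)"
    using quadrature_error_le[OF assms(1-4) m h, of i y] i by simp
  \<comment> \<open>Doubling omega splits off (1/2)^m, which \<open>half\<close> then
    absorbs.\<close>
  also have "\<dots> = 4 * ((2 * \<omega>) ^ m / fact m) * ((a / real N) ^ m * (1 / 2) ^ m)"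
    by (simp add: power_mult_distrib power_divide)
  also have "\<dots> \<le> 4 * exp (2 * \<omega>) * ((a / real N) ^ m * (1 / 2) ^ m)"
    using power_le_fact_exp[of "2 * \<omega>" m] assms(1,2)
    by (intro mult_right_mono) (simp_all add: field_simps)
  also have "\<dots> \<le> (?C / sqrt (2 * pi * real i) * sqrt (real m))
      * ((a / real N) ^ m * ((real m + \<omega>) / (2 * real m - 1)) ^ m)"
    using assms(1) by (intro mult_mono C half) auto
  also have "\<dots> = ?C / sqrt (2 * pi * real i) * (a / real N) ^ m
      * (real m powr (1 / (2 * real m)) * ((real m + \<omega>) / (2 * real m - 1))) ^ m"
    unfolding power_mult_distrib root by (simp only: mult_ac)
  finally show "\<bar>quadrature_error a \<omega> \<kappa> m i h y\<bar> \<le> \<dots>" .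
qed simp

end
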